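(* Let $z\colon[t_0,+\infty)\to\mathcal H$ be a solution of the dynamical system (DS) described in the context, and let $z_*\in\mathcal Z$. Then for every $t\ge t_0$ $$0\le \|V(z(t))\|\le \sqrt{2\mathcal E_{\alpha-1}(t_0)}\cdot\frac{1}{t\beta(t)},\qquad 0\le\langle z(t)-z_*,V(z(t))\rangle\le \frac{\mathcal E_{\alpha-1}(t_0)}{2(\alpha-1)}\cdot\frac{1}{t\beta(t)},$$ and $$\int_{t_0}^{+\infty}t\,w(t)\langle z(t)-z_*,V(z(t))\rangle\,dt<+\infty,\qquad \int_{t_0}^{+\infty}t^2\beta(t)w(t)\|V(z(t))\|^2\,dt<+\infty.$$ If, in addition, $$0\le\sup_{t\ge t_0}\frac{t\dot\beta(t)}{\beta(t)}<\alpha-2,$$ then the trajectory $t\mapsto z(t)$ is bounded, it holds $$\int_{t_0}^{+\infty}t\|\dot z(t)\|^2\,dt<+\infty,$$ and the limit $\lim_{t\to+\infty}\mathcal E_\lambda(t)\in\mathbb R$ exists for every $\lambda$ satisfying $0\le\lambda\le\alpha-1$.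
   Context: $\mathcal H$ is a real Hilbert space, $V\colon\mathcal H\to\mathcal H$ is monotone ($\langle x-y,V(x)-V(y)\rangle\ge0$ for all $x,y\in\mathcal H$) and continuous, and $\mathcal Z:=\{z\in\mathcal H: V(z)=0\}$ is assumed nonempty. Let $t_0>0$, $\alpha\ge2$, $(z^0,\dot z^0)\in\mathcal H\times\mathcal H$, and let $\beta\colon[t_0,+\infty)\to(0,+\infty)$ be continuously differentiable and nondecreasing with $0\le\sup_{t\ge t_0}\frac{t\dot\beta(t)}{\beta(t)}\le\alpha-2$. The dynamical system (DS) on $[t_0,+\infty)$ is $$\ddot z(t)+\frac{\alpha}{t}\dot z(t)+\beta(t)\frac{d}{dt}V(z(t))+\frac12\Big(\dot\beta(t)+\frac{\alpha}{t}\beta(t)\Big)V(z(t))=0,\qquad z(t_0)=z^0,\ \dot z(t_0)=\dot z^0.$$ For a solution $z$, the map $t\mapsto V(z(t))$ is assumed to be differentiable on $[t_0,+\infty)$. For $z_*\in\mathcal Z$ and $0\le\lambda\le\alpha-1$, the energy function is $$\mathcal E_\lambda(t):=\tfrac12\big\|2\lambda(z(t)-z_* )+t\big(2\dot z(t)+\beta(t)V(z(t))\big)\big\|^2+2\lambda(\alpha-1-\lambda)\|z(t)-z_*\|^2+2\lambda t\beta(t)\langle z(t)-z_*,V(z(t))\rangle+\tfrac12t^2\beta^2(t)\|V(z(t))\|^2,$$ and $w\colon[t_0,+\infty)\to\mathbb R$ is $w(t):=\frac12\big((\alpha-2)\frac{\beta(t)}{t}-\dot\beta(t)\big)$. *)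

theory Defs
  imports "HOL-Analysis.Analysis"
begin

definition monotone_operator :: "('a::real_inner \<Rightarrow> 'a) \<Rightarrow> bool" where
  "monotone_operator V \<longleftrightarrow> (\<forall>x y. 0 \<le> (x - y) \<bullet> (V x - V y))"

definition zeros :: "('a::real_inner \<Rightarrow> 'a) \<Rightarrow> 'a set" where
  "zeros V = {x. V x = 0}"

text \<open>Derivative of a curve on the half-line \<open>{t0..}\<close>: one-sided at \<open>t0\<close>, two-sided to the
  right of it. Values of the curve to the left of \<open>t0\<close> play no role.\<close>

definition ddt :: "real \<Rightarrow> (real \<Rightarrow> 'a::real_normed_vector) \<Rightarrow> real \<Rightarrow> 'a" where
  "ddt t0 f t = vector_derivative f (at t within {t0..})"

definition C1_from :: "real \<Rightarrow> (real \<Rightarrow> 'a::real_normed_vector) \<Rightarrow> bool" where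
  "C1_from t0 f \<longleftrightarrow> f differentiable_on {t0..} \<and> continuous_on {t0..} (ddt t0 f)"

text \<open>The supremum is taken in the extended reals, where it is \<open>\<infinity>\<close> if the quotient is
  unbounded.\<close>

definition growth_sup :: "real \<Rightarrow> (real \<Rightarrow> real) \<Rightarrow> ereal" where
  "growth_sup t0 \<beta> = (SUP t\<in>{t0..}. ereal (t * ddt t0 \<beta> t / \<beta> t))"

text \<open>Solutions are classical: \<open>z\<close> is twice differentiable, the curve \<open>t \<mapsto> V (z t)\<close> is
  differentiable, and the equation holds at every time. Continuity of the second derivative
  is not required.\<close>

definition DS_solution ::
  "('a::real_inner \<Rightarrow> 'a) \<Rightarrow> real \<Rightarrow> (real \<Rightarrow> real) \<Rightarrow> real \<Rightarrow> 'a \<Rightarrow> 'a \<Rightarrow> (real \<Rightarrow> 'a) \<Rightarrow> bool" where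
  "DS_solution V \<alpha> \<beta> t0 z0 v0 z \<longleftrightarrow>
     z differentiable_on {t0..} \<and>
     ddt t0 z differentiable_on {t0..} \<and>
     (\<lambda>t. V (z t)) differentiable_on {t0..} \<and>
     (\<forall>t\<ge>t0. ddt t0 (ddt t0 z) t + (\<alpha> / t) *\<^sub>R ddt t0 z t
              + \<beta> t *\<^sub>R ddt t0 (\<lambda>s. V (z s)) t
              + (1/2 * (ddt t0 \<beta> t + \<alpha> / t * \<beta> t)) *\<^sub>R V (z t) = 0) \<and>
     z t0 = z0 \<and> ddt t0 z t0 = v0"

definition energy ::
  "('a::real_inner \<Rightarrow> 'a) \<Rightarrow> real \<Rightarrow> (real \<Rightarrow> real) \<Rightarrow> real \<Rightarrow> (real \<Rightarrow> 'a) \<Rightarrow> 'a \<Rightarrow> real \<Rightarrow> real \<Rightarrow> real" where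
  "energy V \<alpha> \<beta> t0 z zs lam t =
     1/2 * (norm ((2 * lam) *\<^sub>R (z t - zs) + t *\<^sub>R (2 *\<^sub>R ddt t0 z t + \<beta> t *\<^sub>R V (z t))))\<^sup>2
     + 2 * lam * (\<alpha> - 1 - lam) * (norm (z t - zs))\<^sup>2
     + 2 * lam * t * \<beta> t * ((z t - zs) \<bullet> V (z t))
     + 1/2 * t\<^sup>2 * (\<beta> t)\<^sup>2 * (norm (V (z t)))\<^sup>2"

definition weight :: "real \<Rightarrow> (real \<Rightarrow> real) \<Rightarrow> real \<Rightarrow> real \<Rightarrow> real" where
  "weight \<alpha> \<beta> t0 t = 1/2 * ((\<alpha> - 2) * (\<beta> t / t) - ddt t0 \<beta> t)"

end

theory Submission
  imports Defs
begin

text \<open>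
  The proof is a Lyapunov argument. Write \<open>d = z - zs\<close> and \<open>v\<close> for the velocity. Differentiating the
  energy along a solution and eliminating the acceleration by the equation makes most terms cancel
  (\<open>deriv_energy\<close>):
  \<open>E\<^sub>\<lambda>' = - 4\<lambda> t w \<langle>d, V z\<rangle> - 4(\<alpha> - 1 - \<lambda>) t (|v|\<^sup>2 + \<beta> \<langle>v, V z\<rangle>)
         - 2 t\<^sup>2 \<beta> \<langle>v, (V z)'\<rangle> - 2 t\<^sup>2 \<beta> w |V z|\<^sup>2\<close>.
  Monotonicity of \<open>V\<close> makes \<open>\<langle>d, V z\<rangle>\<close> and, through difference quotients, \<open>\<langle>v, (V z)'\<rangle>\<close> nonnegative;
  the growth bound on \<open>\<beta>\<close> says exactly that \<open>w \<ge> 0\<close>. Only the term with factor \<open>\<alpha> - 1 - \<lambda>\<close> has no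
  definite sign.

  For \<open>\<lambda> = \<alpha> - 1\<close> this term is absent, so the energy is nonincreasing. It is a sum of nonnegative
  terms, and bounding single terms by its initial value gives the two decay rates. Whatever the
  energy loses pays for the integrals: a nonnegative continuous function dominated by the
  dissipation of a nonnegative energy is integrable (\<open>set_integrable_of_dissipation\<close>).

  If the growth bound is strict, with a gap \<open>2\<delta>\<close>, then \<open>t w \<ge> \<delta> \<beta>\<close>, and the term in \<open>|V z|\<^sup>2\<close> is strong
  enough to absorb the indefinite cross term for \<open>\<lambda> = \<mu> = \<alpha> - 1 - \<delta>\<close>, leaving
  \<open>E\<^sub>\<mu>' \<le> - 2\<delta> t |v|\<^sup>2\<close> (\<open>energy_rate_strict\<close>). This gives the integrability of \<open>t |v|\<^sup>2\<close>; and since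
  \<open>0 < \<mu> < \<alpha> - 1\<close>, the energy \<open>E\<^sub>\<mu>\<close> controls \<open>|d|\<^sup>2\<close>, so the trajectory is bounded. Finally \<open>E\<^sub>\<lambda>\<close> is an
  affine function of \<open>\<lambda>\<close> (\<open>energy_affine\<close>): the two energies with \<open>\<lambda> = \<mu>\<close> and \<open>\<lambda> = \<alpha> - 1\<close> converge, being
  nonincreasing and nonnegative, and hence so do all the others.
\<close>

section \<open>Monotone operators along differentiable curves\<close>

lemma difference_quotient_tendsto:
  assumes "(f has_vector_derivative D) (at t within S)"
  shows "((\<lambda>s. (1 / (s - t)) *\<^sub>R (f s - f t)) \<longlongrightarrow> D) (at t within S)"
proof -
  have "((\<lambda>s. (1 / norm (s - t)) *\<^sub>R (f s - (f t + (s - t) *\<^sub>R D))) \<longlongrightarrow> 0) (at t within S)"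
    using assms by (auto simp: has_vector_derivative_def has_derivative_within)
  then have "((\<lambda>s. norm ((1 / norm (s - t)) *\<^sub>R (f s - (f t + (s - t) *\<^sub>R D)))) \<longlongrightarrow> 0) (at t within S)"
    by (rule tendsto_norm_zero)
  moreover have "norm ((1 / norm (s - t)) *\<^sub>R (f s - (f t + (s - t) *\<^sub>R D)))
        = norm ((1 / (s - t)) *\<^sub>R (f s - f t) - D)" if "s \<noteq> t" for s
  proof -
    have "(1 / (s - t)) *\<^sub>R (f s - f t) - D = (1 / (s - t)) *\<^sub>R (f s - (f t + (s - t) *\<^sub>R D))"
      using that by (simp add: diff_diff_eq[symmetric] scaleR_diff_right)
    then show ?thesis
      by simp
  qed
  ultimately have "((\<lambda>s. norm ((1 / (s - t)) *\<^sub>R (f s - f t) - D)) \<longlongrightarrow> 0) (at t within S)"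
    by (subst (asm) tendsto_cong) (auto simp: eventually_at_filter)
  then show ?thesis
    by (rule LIM_zero_cancel[OF tendsto_norm_zero_cancel])
qed

text \<open>Monotonicity makes the inner product of the two difference quotients nonnegative, and the
  sign survives in the limit. Hence differentiability of \<open>V\<close> along the curve suffices.\<close>

lemma monotone_operator_derivative_along_curve:
  fixes z :: "real \<Rightarrow> 'a::real_inner"
  assumes "monotone_operator V" and "t islimpt S"
    and "(z has_vector_derivative v) (at t within S)"
    and "((\<lambda>s. V (z s)) has_vector_derivative y) (at t within S)"
  shows "0 \<le> v \<bullet> y"
proof (rule tendsto_lowerbound)
  show "((\<lambda>s. ((1 / (s - t)) *\<^sub>R (z s - z t)) \<bullet> ((1 / (s - t)) *\<^sub>R (V (z s) - V (z t)))) \<longlongrightarrow> v \<bullet> y)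
      (at t within S)"
    by (intro tendsto_inner difference_quotient_tendsto assms)
  show "\<forall>\<^sub>F s in at t within S.
      0 \<le> ((1 / (s - t)) *\<^sub>R (z s - z t)) \<bullet> ((1 / (s - t)) *\<^sub>R (V (z s) - V (z t)))"
    using assms(1) by (simp add: monotone_operator_def)
  show "at t within S \<noteq> bot"
    using assms(2) by (simp add: trivial_limit_within)
qed

section \<open>Lyapunov functions on a half-line\<close>

lemma nonincreasing_of_nonpos_derivative:
  fixes f f' :: "real \<Rightarrow> real"
  assumes deriv: "\<And>t. t \<ge> a \<Longrightarrow> (f has_real_derivative f' t) (at t within {a..})"
    and nonpos: "\<And>t. t \<ge> a \<Longrightarrow> f' t \<le> 0"
    and "a \<le> s" "s \<le> t"
  shows "f t \<le> f s"
proof (rule DERIV_nonpos_imp_decreasing_open[OF \<open>s \<le> t\<close>])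
  fix x assume "s < x" "x < t"
  then have "x \<in> interior {a..}"
    using \<open>a \<le> s\<close> by simp
  then have "(f has_real_derivative f' x) (at x)"
    using deriv[of x] \<open>a \<le> s\<close> \<open>s < x\<close> at_within_interior[of x "{a..}"] by auto
  then show "\<exists>y. (f has_real_derivative y) (at x) \<and> y \<le> 0"
    using nonpos[of x] \<open>a \<le> s\<close> \<open>s < x\<close> by auto
next
  have "continuous_on {a..} f"
    using deriv by (auto intro: DERIV_continuous_on)
  then show "continuous_on {s..t} f"
    by (rule continuous_on_subset) (use \<open>a \<le> s\<close> in auto)
qed

lemma nonincreasing_bounded_below_tendsto:
  fixes f :: "real \<Rightarrow> real"
  assumes anti: "\<And>s t. a \<le> s \<Longrightarrow> s \<le> t \<Longrightarrow> f t \<le> f s"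
    and lower: "\<And>t. a \<le> t \<Longrightarrow> m \<le> f t"
  shows "\<exists>L. (f \<longlongrightarrow> L) at_top"
proof
  have bdd: "bdd_below (f ` {a..})"
    using lower by (auto simp: bdd_below_def)
  show "(f \<longlongrightarrow> Inf (f ` {a..})) at_top"
  proof (rule decreasing_tendsto)
    show "\<forall>\<^sub>F t in at_top. Inf (f ` {a..}) \<le> f t"
      using eventually_ge_at_top[of a] by eventually_elim (auto intro: cInf_lower bdd)
    fix x assume "Inf (f ` {a..}) < x"
    then obtain s where "s \<ge> a" "f s < x"
      using bdd by (auto simp: cInf_less_iff)
    then show "\<forall>\<^sub>F t in at_top. f t < x"
      using anti[of s] by (intro eventually_mono[OF eventually_ge_at_top[of s]]) force
  qed
qed

text \<open>The derivative \<open>E'\<close> need not be continuous or integrable, so the loss of energy cannot be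
  written as an integral of \<open>E'\<close>. Instead \<open>E\<close> plus the primitive \<open>G\<close> of the continuous function \<open>g\<close>
  has a nonpositive derivative, which bounds \<open>G\<close> by the initial energy; monotone convergence
  then yields integrability on the whole half-line.\<close>

lemma set_integrable_of_dissipation:
  fixes E E' g :: "real \<Rightarrow> real"
  assumes deriv: "\<And>t. t \<ge> a \<Longrightarrow> (E has_real_derivative E' t) (at t within {a..})"
    and diss: "\<And>t. t \<ge> a \<Longrightarrow> E' t \<le> - g t"
    and E_nonneg: "\<And>t. t \<ge> a \<Longrightarrow> 0 \<le> E t"
    and cont: "continuous_on {a..} g"
    and g_nonneg: "\<And>t. t \<ge> a \<Longrightarrow> 0 \<le> g t"
  shows "set_integrable lborel {a..} g"
proof -
  have cont_Icc: "continuous_on {a..y} g" for y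
    using cont by (rule continuous_on_subset) auto
  have int_Icc: "set_integrable lborel {a..y} g" for y
    by (rule borel_integrable_atLeastAtMost'[OF cont_Icc])
  define G where "G y = integral {a..y} g" for y
  have G_deriv: "(G has_real_derivative g t) (at t within {a..})" if "t \<ge> a" for t
  proof -
    have "(G has_real_derivative g t) (at t within {a..t + 1})"
      unfolding G_def using integral_has_real_derivative[OF cont_Icc] that by simp
    moreover have "at t within {a..t + 1} = at t within {a..}"
      by (rule at_within_nhd[of _ "{..<t + 1}"]) auto
    ultimately show ?thesis
      by simp
  qed
  have "E t + G t \<le> E a + G a" if "t \<ge> a" for t
  proof (rule nonincreasing_of_nonpos_derivative[of a "\<lambda>t. E t + G t" "\<lambda>t. E' t + g t"])
    show "((\<lambda>t. E t + G t) has_real_derivative E' s + g s) (at s within {a..})" if "s \<ge> a" for s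
      using that by (intro DERIV_add deriv G_deriv)
    show "E' s + g s \<le> 0" if "s \<ge> a" for s
      using diss[OF that] by simp
  qed (use that in auto)
  then have G_le: "G t \<le> E a" if "t \<ge> a" for t
    using E_nonneg[OF that] that by (force simp: G_def)
  have G_mono: "- G t \<le> - G s" if "a \<le> s" "s \<le> t" for s t
    by (rule nonincreasing_of_nonpos_derivative[of a "\<lambda>t. - G t" "\<lambda>t. - g t"])
       (use that g_nonneg in \<open>auto intro!: derivative_eq_intros G_deriv\<close>)
  obtain L where "((\<lambda>t. - G t) \<longlongrightarrow> L) at_top"
    using nonincreasing_bounded_below_tendsto[of a "\<lambda>t. - G t" "- E a"] G_mono G_le by auto
  then have G_lim: "(G \<longlongrightarrow> - L) at_top"
    using tendsto_minus by fastforce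
  have restrict: "(\<lambda>x. indicator {a..} x *\<^sub>R g x * indicator {..y} x) = (\<lambda>x. indicator {a..y} x *\<^sub>R g x)" for y
    by (rule ext) (simp split: split_indicator)
  have "integrable lborel (\<lambda>x. indicator {a..} x *\<^sub>R g x)"
  proof (rule integrable_monotone_convergence_at_top)
    show "integrable lborel (\<lambda>x. indicator {a..} x *\<^sub>R g x * indicator {..y} x)" for y
      using int_Icc unfolding restrict set_integrable_def .
    have "G = (\<lambda>y. \<integral>x. indicator {a..} x *\<^sub>R g x * indicator {..y} x \<partial>lborel)"
      using set_borel_integral_eq_integral(2)[OF int_Icc]
      unfolding restrict by (auto simp: G_def set_lebesgue_integral_def)
    then show "((\<lambda>y. \<integral>x. indicator {a..} x *\<^sub>R g x * indicator {..y} x \<partial>lborel) \<longlongrightarrow> - L) at_top"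
      using G_lim by simp
    show "(\<lambda>x. indicator {a..} x *\<^sub>R g x) \<in> borel_measurable borel"
      using borel_measurable_continuous_on_indicator[OF _ cont] by simp
  qed (use g_nonneg in \<open>auto split: split_indicator\<close>)
  then show ?thesis
    by (simp add: set_integrable_def)
qed

section \<open>Dissipation of the energy along a trajectory\<close>

lemma growth_sup_le_iff:
  assumes "t0 > 0" and "\<And>t. t \<ge> t0 \<Longrightarrow> \<beta> t > 0"
  shows "growth_sup t0 \<beta> \<le> ereal c \<longleftrightarrow> (\<forall>t\<ge>t0. t * ddt t0 \<beta> t \<le> c * \<beta> t)"
  using assms by (simp add: growth_sup_def SUP_le_iff pos_divide_le_eq Ball_def)


locale DS_trajectory =
  fixes V :: "'a::real_inner \<Rightarrow> 'a" and z :: "real \<Rightarrow> 'a" and z0 v0 zs :: 'a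
    and \<alpha> t0 :: real and \<beta> :: "real \<Rightarrow> real"
  assumes monotone: "monotone_operator V"
    and t0_pos: "t0 > 0" and alpha_ge_2: "\<alpha> \<ge> 2"
    and beta_pos: "\<And>t. t \<ge> t0 \<Longrightarrow> \<beta> t > 0"
    and beta_C1: "C1_from t0 \<beta>"
    and beta_growth: "\<And>t. t \<ge> t0 \<Longrightarrow> t * ddt t0 \<beta> t \<le> (\<alpha> - 2) * \<beta> t"
    and solution: "DS_solution V \<alpha> \<beta> t0 z0 v0 z"
    and zero: "V zs = 0"
begin

abbreviation "v \<equiv> ddt t0 z"
abbreviation "Vz \<equiv> (\<lambda>t. V (z t))"
abbreviation "w \<equiv> weight \<alpha> \<beta> t0"
abbreviation "E \<equiv> energy V \<alpha> \<beta> t0 z zs"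

lemma has_ddt:
  assumes "f differentiable_on {t0..}" "t \<ge> t0"
  shows "(f has_vector_derivative ddt t0 f t) (at t within {t0..})"
  using assms by (auto simp: ddt_def differentiable_on_def vector_derivative_works)

lemma deriv_z: "t \<ge> t0 \<Longrightarrow> (z has_vector_derivative v t) (at t within {t0..})"
  and deriv_v: "t \<ge> t0 \<Longrightarrow> (v has_vector_derivative ddt t0 v t) (at t within {t0..})"
  and deriv_Vz: "t \<ge> t0 \<Longrightarrow> (Vz has_vector_derivative ddt t0 Vz t) (at t within {t0..})"
  and deriv_beta: "t \<ge> t0 \<Longrightarrow> (\<beta> has_real_derivative ddt t0 \<beta> t) (at t within {t0..})"
  using solution beta_C1
  by (auto intro!: has_ddt simp: DS_solution_def C1_from_def has_real_derivative_iff_has_vector_derivative)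

lemma continuous_z: "continuous_on {t0..} z"
  and continuous_v: "continuous_on {t0..} v"
  and continuous_Vz: "continuous_on {t0..} Vz"
  and continuous_beta: "continuous_on {t0..} \<beta>"
  and continuous_w: "continuous_on {t0..} w"
proof -
  show "continuous_on {t0..} z" "continuous_on {t0..} v" "continuous_on {t0..} Vz"
    and beta: "continuous_on {t0..} \<beta>"
    using solution beta_C1
    by (auto simp: DS_solution_def C1_from_def intro: differentiable_imp_continuous_on)
  show "continuous_on {t0..} w"
    unfolding weight_def using beta beta_C1 t0_pos
    by (intro continuous_intros) (auto simp: C1_from_def)
qed

lemma inner_Vz_nonneg: "0 \<le> (z t - zs) \<bullet> V (z t)"
  using monotone zero by (auto simp: monotone_operator_def dest: spec2[of _ "z t" zs])

lemma velocity_inner_nonneg: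
  assumes "t \<ge> t0"
  shows "0 \<le> v t \<bullet> ddt t0 Vz t"
proof (rule monotone_operator_derivative_along_curve[OF monotone])
  show "t islimpt {t0..}"
    by (rule islimpt_subset[OF islimpt_greaterThanLessThan1[of t "t + 1"]]) (use assms in auto)
qed (use assms deriv_z deriv_Vz in auto)

lemma weight_eq:
  assumes "t \<ge> t0"
  shows "2 * (t * w t) = (\<alpha> - 2) * \<beta> t - t * ddt t0 \<beta> t"
  using assms t0_pos by (simp add: weight_def field_simps)

lemma weight_nonneg: "t \<ge> t0 \<Longrightarrow> 0 \<le> t * w t"
  using weight_eq[of t] beta_growth[of t] by simp

lemma deriv_inner:
  assumes "(f has_vector_derivative f') (at t within S)" "(g has_vector_derivative g') (at t within S)"
  shows "((\<lambda>s. f s \<bullet> g s) has_real_derivative (f t \<bullet> g' + f' \<bullet> g t)) (at t within S)"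
  using bounded_bilinear.has_vector_derivative[OF bounded_bilinear_inner assms]
  by (simp add: has_real_derivative_iff_has_vector_derivative)

text \<open>The derivative of the energy, with the terms grouped by sign: for \<open>0 \<le> lam \<le> \<alpha> - 1\<close> every
  summand but the second is nonpositive. The weight enters only through \<open>t * w t\<close>, which is free of
  divisions (\<open>weight_eq\<close>).\<close>

definition energy_rate :: "real \<Rightarrow> real \<Rightarrow> real" where
  "energy_rate lam t =
     - (4 * lam * (t * w t) * ((z t - zs) \<bullet> V (z t)))
     - 4 * (\<alpha> - 1 - lam) * t * (v t \<bullet> v t + \<beta> t * (v t \<bullet> V (z t)))
     - 2 * t\<^sup>2 * \<beta> t * (v t \<bullet> ddt t0 Vz t)
     - 2 * t * \<beta> t * (t * w t) * (V (z t) \<bullet> V (z t))"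

text \<open>The vector \<open>u\<close> inside the first norm is designed so that the acceleration, which occurs as
  \<open>2t v'\<close>, is eliminated by \<open>2t\<close> times the equation: its derivative \<open>u'\<close> contains only \<open>v\<close>, \<open>V z\<close> and
  \<open>(V z)'\<close>. In the resulting energy balance the coefficients of \<open>\<langle>d, v\<rangle>\<close>, \<open>\<langle>d, (V z)'\<rangle>\<close> and
  \<open>\<langle>V z, (V z)'\<rangle>\<close> vanish.\<close>

lemma deriv_energy:
  assumes "t \<ge> t0"
  shows "(E lam has_real_derivative energy_rate lam t) (at t within {t0..})"
proof -
  define u where "u s = (2 * lam) *\<^sub>R (z s - zs) + s *\<^sub>R (2 *\<^sub>R v s + \<beta> s *\<^sub>R V (z s))" for s
  define u' where "u' = (2 * lam + 2 - 2 * \<alpha>) *\<^sub>R v t - ((\<alpha> - 1) * \<beta> t) *\<^sub>R V (z t)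
      - (t * \<beta> t) *\<^sub>R ddt t0 Vz t"
  define d where "d s = z s - zs" for s
  have "t > 0"
    using assms t0_pos by simp
  have deriv_d: "(d has_vector_derivative v t) (at t within {t0..})"
    unfolding d_def by (auto intro!: derivative_eq_intros deriv_z assms)
  have "(2 * t) *\<^sub>R (ddt t0 v t + (\<alpha> / t) *\<^sub>R v t + \<beta> t *\<^sub>R ddt t0 Vz t
              + (1/2 * (ddt t0 \<beta> t + \<alpha> / t * \<beta> t)) *\<^sub>R V (z t)) = 0"
    using solution assms by (simp add: DS_solution_def)
  moreover have "2 * t * (\<alpha> / t) = 2 * \<alpha>"
    and "2 * t * (1/2 * (ddt t0 \<beta> t + \<alpha> / t * \<beta> t)) = t * ddt t0 \<beta> t + \<alpha> * \<beta> t"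
    using \<open>t > 0\<close> by (simp_all add: field_simps)
  ultimately have "(2 * t) *\<^sub>R ddt t0 v t + (2 * \<alpha>) *\<^sub>R v t + (2 * t * \<beta> t) *\<^sub>R ddt t0 Vz t
      + (t * ddt t0 \<beta> t + \<alpha> * \<beta> t) *\<^sub>R V (z t) = 0"
    by (simp only: scaleR_add_right scaleR_scaleR)
  \<comment> \<open>Split in two halves, one of which cancels against the \<open>t \<beta> (V z)'\<close> from differentiating \<open>u\<close>.\<close>
  moreover have "(2 * t * \<beta> t) *\<^sub>R ddt t0 Vz t = (t * \<beta> t) *\<^sub>R ddt t0 Vz t + (t * \<beta> t) *\<^sub>R ddt t0 Vz t"
    by (simp add: scaleR_left_distrib[symmetric])
  ultimately have acceleration: "(2 * t) *\<^sub>R ddt t0 v t =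
      - ((2 * \<alpha>) *\<^sub>R v t + ((t * \<beta> t) *\<^sub>R ddt t0 Vz t + (t * \<beta> t) *\<^sub>R ddt t0 Vz t)
         + (t * ddt t0 \<beta> t + \<alpha> * \<beta> t) *\<^sub>R V (z t))"
    by (simp only: eq_neg_iff_add_eq_0 add.assoc)
  have "(u has_vector_derivative (2 * lam) *\<^sub>R v t + (2 *\<^sub>R v t + \<beta> t *\<^sub>R V (z t))
      + t *\<^sub>R (2 *\<^sub>R ddt t0 v t + ddt t0 \<beta> t *\<^sub>R V (z t) + \<beta> t *\<^sub>R ddt t0 Vz t)) (at t within {t0..})"
    unfolding u_def
    by (auto intro!: derivative_eq_intros deriv_z deriv_v deriv_Vz deriv_beta assms simp: algebra_simps)
  moreover have "(2 * lam) *\<^sub>R v t + (2 *\<^sub>R v t + \<beta> t *\<^sub>R V (z t))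
      + t *\<^sub>R (2 *\<^sub>R ddt t0 v t + ddt t0 \<beta> t *\<^sub>R V (z t) + \<beta> t *\<^sub>R ddt t0 Vz t) = u'"
  proof -
    have "t *\<^sub>R (2 *\<^sub>R ddt t0 v t + ddt t0 \<beta> t *\<^sub>R V (z t) + \<beta> t *\<^sub>R ddt t0 Vz t)
        = (2 * t) *\<^sub>R ddt t0 v t + (t * ddt t0 \<beta> t) *\<^sub>R V (z t) + (t * \<beta> t) *\<^sub>R ddt t0 Vz t"
      by (simp add: scaleR_add_right mult.commute)
    then show ?thesis
      unfolding acceleration u'_def by (simp add: algebra_simps)
  qed
  ultimately have deriv_u: "(u has_vector_derivative u') (at t within {t0..})"
    by simp
  have energy_eq: "E lam = (\<lambda>s. 1/2 * (u s \<bullet> u s) + 2 * lam * (\<alpha> - 1 - lam) * (d s \<bullet> d s)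
      + 2 * lam * s * \<beta> s * (d s \<bullet> V (z s)) + 1/2 * s\<^sup>2 * (\<beta> s)\<^sup>2 * (V (z s) \<bullet> V (z s)))"
    by (simp add: fun_eq_iff energy_def u_def d_def power2_norm_eq_inner)
  have "(E lam has_real_derivative
      u t \<bullet> u' + 4 * lam * (\<alpha> - 1 - lam) * (d t \<bullet> v t)
      + 2 * lam * (\<beta> t + t * ddt t0 \<beta> t) * (d t \<bullet> V (z t))
      + 2 * lam * t * \<beta> t * (d t \<bullet> ddt t0 Vz t + v t \<bullet> V (z t))
      + t * \<beta> t * (\<beta> t + t * ddt t0 \<beta> t) * (V (z t) \<bullet> V (z t))
      + t\<^sup>2 * (\<beta> t)\<^sup>2 * (V (z t) \<bullet> ddt t0 Vz t)) (at t within {t0..})"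
    unfolding energy_eq
    by (rule derivative_eq_intros deriv_inner deriv_u deriv_d deriv_Vz deriv_beta assms refl)+
       (simp add: inner_commute power2_eq_square algebra_simps)
  moreover have "u t \<bullet> u' + 4 * lam * (\<alpha> - 1 - lam) * (d t \<bullet> v t)
      + 2 * lam * (\<beta> t + t * ddt t0 \<beta> t) * (d t \<bullet> V (z t))
      + 2 * lam * t * \<beta> t * (d t \<bullet> ddt t0 Vz t + v t \<bullet> V (z t))
      + t * \<beta> t * (\<beta> t + t * ddt t0 \<beta> t) * (V (z t) \<bullet> V (z t))
      + t\<^sup>2 * (\<beta> t)\<^sup>2 * (V (z t) \<bullet> ddt t0 Vz t) = energy_rate lam t"
  proof -
    have tw: "t * w t = ((\<alpha> - 2) * \<beta> t - t * ddt t0 \<beta> t) / 2"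
      using weight_eq[OF assms] by simp
    show ?thesis
      unfolding energy_rate_def tw u'_def u_def d_def[symmetric]
      by (simp add: inner_simps inner_commute power2_eq_square field_simps)
  qed
  ultimately show ?thesis
    by simp
qed

lemma energy_nonneg:
  assumes "t \<ge> t0" "0 \<le> lam" "lam \<le> \<alpha> - 1"
  shows "0 \<le> E lam t"
  unfolding energy_def using assms t0_pos beta_pos[of t] inner_Vz_nonneg[of t]
  by (intro add_nonneg_nonneg mult_nonneg_nonneg) auto

section \<open>Decay rates and integrability\<close>

text \<open>For \<open>\<lambda> = \<alpha> - 1\<close> the indefinite summand of the rate vanishes and every remaining one
  dissipates. The two dissipation terms that are kept are continuous in \<open>t\<close>, unlike the one that
  contains \<open>(V z)'\<close>, which need not be.\<close>

lemma energy_rate_top_le: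
  assumes "t \<ge> t0"
  shows "energy_rate (\<alpha> - 1) t \<le> - (4 * (\<alpha> - 1) * (t * w t * ((z t - zs) \<bullet> V (z t))))
     - 2 * (t\<^sup>2 * \<beta> t * w t * (norm (V (z t)))\<^sup>2)"
proof -
  have "0 \<le> 2 * t\<^sup>2 * \<beta> t * (v t \<bullet> ddt t0 Vz t)"
    using velocity_inner_nonneg[OF assms] beta_pos[OF assms] by simp
  then show ?thesis
    unfolding energy_rate_def power2_norm_eq_inner by (simp add: power2_eq_square mult_ac)
qed

lemma weighted_inner_nonneg: "t \<ge> t0 \<Longrightarrow> 0 \<le> t * w t * ((z t - zs) \<bullet> V (z t))"
  using weight_nonneg inner_Vz_nonneg by simp

lemma weighted_norm_nonneg:
  assumes "t \<ge> t0"
  shows "0 \<le> t\<^sup>2 * \<beta> t * w t * (norm (V (z t)))\<^sup>2"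
proof -
  have eq: "t\<^sup>2 * \<beta> t * w t * (norm (V (z t)))\<^sup>2 = t * \<beta> t * (t * w t) * (norm (V (z t)))\<^sup>2"
    by (simp add: power2_eq_square)
  show ?thesis
    unfolding eq using assms weight_nonneg[OF assms] beta_pos[OF assms] t0_pos
    by (intro mult_nonneg_nonneg[OF mult_nonneg_nonneg]) auto
qed

lemma energy_top_antimono:
  assumes "t0 \<le> s" "s \<le> t"
  shows "E (\<alpha> - 1) t \<le> E (\<alpha> - 1) s"
proof (rule nonincreasing_of_nonpos_derivative[OF deriv_energy _ assms])
  fix r assume "t0 \<le> r"
  then show "energy_rate (\<alpha> - 1) r \<le> 0"
    using energy_rate_top_le[of r] weighted_inner_nonneg[of r] weighted_norm_nonneg[of r] alpha_ge_2
    by (smt (verit) mult_nonneg_nonneg)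
qed

text \<open>Both rates follow by keeping one summand of the energy at time \<open>t\<close> and bounding it by the
  initial energy.\<close>

lemma norm_Vz_le:
  assumes "t \<ge> t0"
  shows "norm (V (z t)) \<le> sqrt (2 * E (\<alpha> - 1) t0) * (1 / (t * \<beta> t))"
proof -
  have "0 < t" "0 < \<beta> t"
    using assms t0_pos beta_pos by auto
  then have pos: "0 < t * \<beta> t"
    by simp
  have "0 \<le> 2 * (\<alpha> - 1) * (t * \<beta> t) * ((z t - zs) \<bullet> V (z t))"
    using \<open>0 < t\<close> \<open>0 < \<beta> t\<close> alpha_ge_2 inner_Vz_nonneg[of t] by simp
  then have "1/2 * t\<^sup>2 * (\<beta> t)\<^sup>2 * (norm (V (z t)))\<^sup>2 \<le> E (\<alpha> - 1) t"
    unfolding energy_def by (simp add: mult.assoc)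
  also have "\<dots> \<le> E (\<alpha> - 1) t0"
    using assms by (simp add: energy_top_antimono)
  finally have "(t * \<beta> t * norm (V (z t)))\<^sup>2 \<le> 2 * E (\<alpha> - 1) t0"
    by (simp add: power_mult_distrib)
  then have "t * \<beta> t * norm (V (z t)) \<le> sqrt (2 * E (\<alpha> - 1) t0)"
    by (rule real_le_rsqrt)
  then show ?thesis
    using pos by (simp add: pos_le_divide_eq mult.commute)
qed

lemma inner_Vz_le:
  assumes "t \<ge> t0"
  shows "(z t - zs) \<bullet> V (z t) \<le> E (\<alpha> - 1) t0 / (2 * (\<alpha> - 1)) * (1 / (t * \<beta> t))"
proof -
  have pos: "0 < 2 * (\<alpha> - 1) * (t * \<beta> t)"
    using assms t0_pos beta_pos alpha_ge_2 by simp
  have "2 * (\<alpha> - 1) * t * \<beta> t * ((z t - zs) \<bullet> V (z t)) \<le> E (\<alpha> - 1) t"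
    unfolding energy_def by simp
  also have "\<dots> \<le> E (\<alpha> - 1) t0"
    using assms by (simp add: energy_top_antimono)
  finally have "(z t - zs) \<bullet> V (z t) * (2 * (\<alpha> - 1) * (t * \<beta> t)) \<le> E (\<alpha> - 1) t0"
    by (simp add: mult_ac)
  then show ?thesis
    using pos by (simp add: pos_le_divide_eq)
qed

lemma integrable_weighted_inner:
  "set_integrable lborel {t0..} (\<lambda>t. t * w t * ((z t - zs) \<bullet> V (z t)))"
proof (rule set_integrable_of_dissipation[OF deriv_energy])
  fix t assume t: "t \<ge> t0"
  show "energy_rate (\<alpha> - 1) t \<le> - (t * w t * ((z t - zs) \<bullet> V (z t)))"
    using energy_rate_top_le[OF t] weighted_inner_nonneg[OF t] weighted_norm_nonneg[OF t] alpha_ge_2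
      mult_right_mono[of 1 "4 * (\<alpha> - 1)" "t * w t * ((z t - zs) \<bullet> V (z t))"]
    by simp
qed (use alpha_ge_2 energy_nonneg weighted_inner_nonneg in
  \<open>auto intro!: continuous_intros continuous_w continuous_z continuous_Vz\<close>)

lemma integrable_weighted_norm:
  "set_integrable lborel {t0..} (\<lambda>t. t\<^sup>2 * \<beta> t * w t * (norm (V (z t)))\<^sup>2)"
proof (rule set_integrable_of_dissipation[OF deriv_energy])
  fix t assume t: "t \<ge> t0"
  show "energy_rate (\<alpha> - 1) t \<le> - (t\<^sup>2 * \<beta> t * w t * (norm (V (z t)))\<^sup>2)"
    using energy_rate_top_le[OF t] weighted_norm_nonneg[OF t] alpha_ge_2
      mult_nonneg_nonneg[of "4 * (\<alpha> - 1)", OF _ weighted_inner_nonneg[OF t]]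
    by simp
qed (use alpha_ge_2 energy_nonneg weighted_norm_nonneg in
  \<open>auto intro!: continuous_intros continuous_w continuous_beta continuous_Vz\<close>)

text \<open>The quadratic part of the energy in \<open>\<lambda>\<close> cancels: the squared norm contributes
  \<open>2 \<lambda>\<^sup>2 |d|\<^sup>2\<close> and the second summand contributes \<open>- 2 \<lambda>\<^sup>2 |d|\<^sup>2\<close>.\<close>

lemma energy_affine:
  "E ((1 - s) * a + s * b) t = (1 - s) * E a t + s * E b t"
  unfolding energy_def power2_norm_eq_inner
  by (simp add: inner_simps inner_commute algebra_simps power2_eq_square)

end

section \<open>Strict growth bound: boundedness and convergence of the energies\<close>

text \<open>The gap in the growth bound is called \<open>2 * \<delta>\<close> so that \<open>t * w t \<ge> \<delta> * \<beta> t\<close>. Keeping it at most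
  \<open>\<alpha> - 2\<close> places \<open>\<mu> = \<alpha> - 1 - \<delta>\<close> strictly between \<open>0\<close> and \<open>\<alpha> - 1\<close>.\<close>

locale DS_trajectory_strict = DS_trajectory +
  fixes \<delta> :: real
  assumes delta_pos: "\<delta> > 0" and delta_le: "2 * \<delta> \<le> \<alpha> - 2"
    and beta_growth_strict: "\<And>t. t \<ge> t0 \<Longrightarrow> t * ddt t0 \<beta> t \<le> (\<alpha> - 2 - 2 * \<delta>) * \<beta> t"
begin

abbreviation "\<mu> \<equiv> \<alpha> - 1 - \<delta>"

lemma mu_bounds: "0 < \<mu>" "\<mu> < \<alpha> - 1"
  using delta_pos delta_le by auto

text \<open>With \<open>\<lambda> = \<mu>\<close> the indefinite summand and the one with \<open>|V z|\<^sup>2\<close> add up to at most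
  \<open>- 4\<delta> t (|v|\<^sup>2 + \<beta> \<langle>v, V z\<rangle>) - 2\<delta> t \<beta>\<^sup>2 |V z|\<^sup>2 = - 2\<delta> t |v|\<^sup>2 - 2\<delta> t |v + \<beta> V z|\<^sup>2\<close>;
  this identity is why \<open>\<delta>\<close> is half of the gap.\<close>

lemma energy_rate_strict:
  assumes t: "t \<ge> t0"
  shows "energy_rate \<mu> t \<le> - (2 * \<delta> * (t * (norm (v t))\<^sup>2))"
proof -
  have "0 < t" "0 < \<beta> t"
    using t t0_pos beta_pos by auto
  have "\<delta> * \<beta> t \<le> t * w t"
    using weight_eq[OF t] beta_growth_strict[OF t] by (simp add: algebra_simps)
  then have "2 * t * \<beta> t * (\<delta> * \<beta> t) * (V (z t) \<bullet> V (z t)) \<le> 2 * t * \<beta> t * (t * w t) * (V (z t) \<bullet> V (z t))"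
    using \<open>0 < t\<close> \<open>0 < \<beta> t\<close> by (intro mult_right_mono mult_left_mono) auto
  moreover have "0 \<le> 2 * \<delta> * t * ((v t + \<beta> t *\<^sub>R V (z t)) \<bullet> (v t + \<beta> t *\<^sub>R V (z t)))"
    using \<open>0 < t\<close> delta_pos by simp
  moreover have "0 \<le> 2 * t\<^sup>2 * \<beta> t * (v t \<bullet> ddt t0 Vz t)"
    using velocity_inner_nonneg[OF t] \<open>0 < \<beta> t\<close> by simp
  moreover have "0 \<le> 4 * \<mu> * (t * w t) * ((z t - zs) \<bullet> V (z t))"
    using mu_bounds(1) weight_nonneg[OF t] inner_Vz_nonneg[of t] by simp
  ultimately show ?thesis
    unfolding energy_rate_def
    by (simp add: power2_norm_eq_inner inner_simps inner_commute algebra_simps)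
qed

lemma energy_mu_antimono:
  assumes "t0 \<le> s" "s \<le> t"
  shows "E \<mu> t \<le> E \<mu> s"
proof (rule nonincreasing_of_nonpos_derivative[OF deriv_energy _ assms])
  fix r assume r: "t0 \<le> r"
  then have "0 \<le> 2 * \<delta> * (r * (norm (v r))\<^sup>2)"
    using t0_pos delta_pos by simp
  then show "energy_rate \<mu> r \<le> 0"
    using energy_rate_strict[OF r] by simp
qed

text \<open>The coefficient \<open>c = 2 \<mu> (\<alpha> - 1 - \<mu>)\<close> of \<open>|z - zs|\<^sup>2\<close> in the energy vanishes at
  \<open>\<lambda> = 0\<close> and \<open>\<lambda> = \<alpha> - 1\<close>, but is positive at \<open>\<lambda> = \<mu>\<close>.\<close>

lemma bounded_trajectory: "bounded (z ` {t0..})"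
proof -
  define c where "c = 2 * \<mu> * (\<alpha> - 1 - \<mu>)"
  have "0 < c"
    using mu_bounds unfolding c_def by simp
  have "norm (z t - zs) \<le> sqrt (E \<mu> t0 / c)" if t: "t \<ge> t0" for t
  proof -
    have "0 \<le> 2 * \<mu> * t * \<beta> t * ((z t - zs) \<bullet> V (z t))"
      using t t0_pos mu_bounds(1) beta_pos[OF t] inner_Vz_nonneg[of t] by simp
    then have "c * (norm (z t - zs))\<^sup>2 \<le> E \<mu> t"
      unfolding energy_def c_def[symmetric] by simp
    also have "\<dots> \<le> E \<mu> t0"
      using t by (simp add: energy_mu_antimono)
    finally show ?thesis
      using \<open>0 < c\<close> by (intro real_le_rsqrt) (simp add: pos_le_divide_eq mult.commute)
  qed
  then have "z ` {t0..} \<subseteq> cball zs (sqrt (E \<mu> t0 / c))"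
    by (auto simp: dist_norm norm_minus_commute)
  then show ?thesis
    by (rule bounded_subset[OF bounded_cball])
qed

lemma integrable_velocity: "set_integrable lborel {t0..} (\<lambda>t. t * (norm (v t))\<^sup>2)"
proof -
  have "set_integrable lborel {t0..} (\<lambda>t. 2 * \<delta> * (t * (norm (v t))\<^sup>2))"
    by (rule set_integrable_of_dissipation[OF deriv_energy energy_rate_strict])
       (use mu_bounds delta_pos t0_pos energy_nonneg in \<open>auto intro!: continuous_intros continuous_v\<close>)
  then show ?thesis
    using delta_pos by simp
qed

lemma energy_convergent: "\<exists>L. (E lam \<longlongrightarrow> L) at_top"
proof -
  obtain L where L: "(E \<mu> \<longlongrightarrow> L) at_top"
    using nonincreasing_bounded_below_tendsto[of t0 "E \<mu>" 0] energy_mu_antimono energy_nonneg mu_bounds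
    by auto
  obtain M where M: "(E (\<alpha> - 1) \<longlongrightarrow> M) at_top"
    using nonincreasing_bounded_below_tendsto[of t0 "E (\<alpha> - 1)" 0] energy_top_antimono energy_nonneg alpha_ge_2
    by auto
  \<comment> \<open>The affine coordinate of \<open>lam\<close> on the line through \<open>\<mu>\<close> (value 0) and \<open>\<alpha> - 1 = \<mu> + \<delta>\<close> (value 1).\<close>
  define s where "s = (lam - \<mu>) / \<delta>"
  have "lam = (1 - s) * \<mu> + s * (\<alpha> - 1)"
    using delta_pos unfolding s_def by (simp add: field_simps)
  then have "E lam = (\<lambda>t. (1 - s) * E \<mu> t + s * E (\<alpha> - 1) t)"
    using energy_affine[of s \<mu> "\<alpha> - 1"] by auto
  moreover have "((\<lambda>t. (1 - s) * E \<mu> t + s * E (\<alpha> - 1) t) \<longlongrightarrow> (1 - s) * L + s * M) at_top"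
    by (intro tendsto_intros L M)
  ultimately show ?thesis
    by auto
qed

end

section \<open>Rates, integrability and convergence\<close>

theorem theorem4:
  fixes V :: "'a::{real_inner, complete_space} \<Rightarrow> 'a"
    and z :: "real \<Rightarrow> 'a" and z0 v0 zs :: 'a
    and \<alpha> t0 :: real and \<beta> :: "real \<Rightarrow> real"
  assumes "monotone_operator V" and "continuous_on UNIV V"
    and "t0 > 0" and "\<alpha> \<ge> 2"
    and "\<And>t. t \<ge> t0 \<Longrightarrow> \<beta> t > 0" and "C1_from t0 \<beta>" and "mono_on {t0..} \<beta>"
    and "0 \<le> growth_sup t0 \<beta>" and "growth_sup t0 \<beta> \<le> ereal (\<alpha> - 2)"
    and "DS_solution V \<alpha> \<beta> t0 z0 v0 z"
    and "zs \<in> zeros V"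
  shows "(\<forall>t\<ge>t0.
            0 \<le> norm (V (z t)) \<and>
            norm (V (z t)) \<le> sqrt (2 * energy V \<alpha> \<beta> t0 z zs (\<alpha> - 1) t0) * (1 / (t * \<beta> t)) \<and>
            0 \<le> (z t - zs) \<bullet> V (z t) \<and>
            (z t - zs) \<bullet> V (z t)
              \<le> energy V \<alpha> \<beta> t0 z zs (\<alpha> - 1) t0 / (2 * (\<alpha> - 1)) * (1 / (t * \<beta> t))) \<and>
         set_integrable lborel {t0..}
           (\<lambda>t. t * weight \<alpha> \<beta> t0 t * ((z t - zs) \<bullet> V (z t))) \<and>
         set_integrable lborel {t0..}
           (\<lambda>t. t\<^sup>2 * \<beta> t * weight \<alpha> \<beta> t0 t * (norm (V (z t)))\<^sup>2) \<and>
         (0 \<le> growth_sup t0 \<beta> \<and> growth_sup t0 \<beta> < ereal (\<alpha> - 2) \<longrightarrow>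
            bounded (z ` {t0..}) \<and>
            set_integrable lborel {t0..} (\<lambda>t. t * (norm (ddt t0 z t))\<^sup>2) \<and>
            (\<forall>lam. 0 \<le> lam \<and> lam \<le> \<alpha> - 1 \<longrightarrow>
               (\<exists>L::real. (energy V \<alpha> \<beta> t0 z zs lam \<longlongrightarrow> L) at_top)))"
proof -
  interpret DS_trajectory V z z0 v0 zs \<alpha> t0 \<beta>
    using assms growth_sup_le_iff[of t0 \<beta> "\<alpha> - 2"]
    by unfold_locales (auto simp: zeros_def)
  have "bounded (z ` {t0..}) \<and> set_integrable lborel {t0..} (\<lambda>t. t * (norm (v t))\<^sup>2)
      \<and> (\<forall>lam. 0 \<le> lam \<and> lam \<le> \<alpha> - 1 \<longrightarrow> (\<exists>L::real. (E lam \<longlongrightarrow> L) at_top))"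
    if strict: "0 \<le> growth_sup t0 \<beta>" "growth_sup t0 \<beta> < ereal (\<alpha> - 2)"
  proof -
    obtain q where q: "growth_sup t0 \<beta> = ereal q"
      using strict by (cases "growth_sup t0 \<beta>") auto
    \<comment> \<open>Half of the gap; it is at most \<open>(\<alpha> - 2) / 2\<close> because the supremum \<open>q\<close> is nonnegative.\<close>
    interpret DS_trajectory_strict V z z0 v0 zs \<alpha> t0 \<beta> "(\<alpha> - 2 - q) / 2"
    proof unfold_locales
      show "0 < (\<alpha> - 2 - q) / 2" "2 * ((\<alpha> - 2 - q) / 2) \<le> \<alpha> - 2"
        using strict q by auto
      have "\<alpha> - 2 - 2 * ((\<alpha> - 2 - q) / 2) = q"
        by (simp add: field_simps)
      moreover have "\<forall>t\<ge>t0. t * ddt t0 \<beta> t \<le> q * \<beta> t"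
        using growth_sup_le_iff[of t0 \<beta> q, OF t0_pos beta_pos] q by simp
      ultimately show "t * ddt t0 \<beta> t \<le> (\<alpha> - 2 - 2 * ((\<alpha> - 2 - q) / 2)) * \<beta> t" if "t \<ge> t0" for t
        using that by simp
    qed
    show ?thesis
      using bounded_trajectory integrable_velocity energy_convergent by blast
  qed
  then show ?thesis
    using norm_Vz_le inner_Vz_le inner_Vz_nonneg integrable_weighted_inner integrable_weighted_norm
    by simp
qed

end
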